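(* For $\alpha,\beta\in\mathscr{PO}_\infty(\mathbb{N}^2_\leqslant)$ the following conditions are equivalent: (i) $\alpha\sigma\beta$, i.e. there exists $\varepsilon\in E(\mathscr{PO}_\infty(\mathbb{N}^2_\leqslant))$ such that $\alpha\varepsilon=\beta\varepsilon$; (ii) there exist $\varsigma,\upsilon\in E(\mathscr{PO}_\infty(\mathbb{N}^2_\leqslant))$ such that $\alpha\varsigma=\beta\upsilon$; (iii) there exist $\varsigma,\upsilon\in E(\mathscr{PO}_\infty(\mathbb{N}^2_\leqslant))$ such that $\alpha\varsigma=\upsilon\beta$; (iv) there exists $\iota\in E(\mathscr{PO}_\infty(\mathbb{N}^2_\leqslant))$ such that $\iota\alpha=\iota\beta$; (v) there exist $\varsigma,\upsilon\in E(\mathscr{PO}_\infty(\mathbb{N}^2_\leqslant))$ such that $\varsigma\alpha=\upsilon\beta$. Thus $\sigma$ is a congruence on the semigroup $\mathscr{PO}_\infty(\mathbb{N}^2_\leqslant)$.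
   Context: $\mathbb{N}$ is the set of positive integers with its usual order, and $\mathbb{N}^2_\leqslant$ is $\mathbb{N}\times\mathbb{N}$ with the product order: $(i,m)\leqslant(j,n)$ iff $i\le j$ and $m\le n$. Partial maps are written on the right and composed left to right: $x(\alpha\beta)=(x\alpha)\beta$, with $\operatorname{dom}(\alpha\beta)=\{y\in\operatorname{dom}\alpha : y\alpha\in\operatorname{dom}\beta\}$. A partial map $\alpha\colon X\rightharpoonup X$ of a poset is monotone if $x\leqslant y$ implies $(x)\alpha\leqslant(y)\alpha$ for all $x,y\in\operatorname{dom}\alpha$. $\mathscr{PO}_\infty(\mathbb{N}^2_\leqslant)$ is the monoid, under composition, of all injective monotone partial selfmaps $\alpha$ of $\mathbb{N}^2_\leqslant$ such that $\operatorname{dom}\alpha$ and $\operatorname{ran}\alpha$ have finite complement in $\mathbb{N}\times\mathbb{N}$. $E(S)$ denotes the set of idempotents of a semigroup $S$. *)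

theory Defs
  imports "HOL-Algebra.Group" "HOL-Library.Product_Order"
begin

definition NN :: "(nat \<times> nat) set" where
  "NN = {1..} \<times> {1..}"

(* The order on nat \<times> nat is the componentwise order of Product_Order. *)

definition PO_inf_maps :: "(nat \<times> nat \<rightharpoonup> nat \<times> nat) set" where
  "PO_inf_maps = {f. dom f \<subseteq> NN \<and> ran f \<subseteq> NN
     \<and> inj_on f (dom f)
     \<and> mono_on (dom f) (\<lambda>x. the (f x))
     \<and> finite (NN - dom f) \<and> finite (NN - ran f)}"

(* Maps are written on the right: the product of f and g is "first f, then g". *)

definition PO_inf :: "(nat \<times> nat \<rightharpoonup> nat \<times> nat) monoid" where
  "PO_inf = \<lparr>carrier = PO_inf_maps, mult = (\<lambda>f g. g \<circ>\<^sub>m f), one = Some |` NN\<rparr>"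

definition idempotents :: "('a, 'm) monoid_scheme \<Rightarrow> 'a set" where
  "idempotents S = {e \<in> carrier S. e \<otimes>\<^bsub>S\<^esub> e = e}"

definition sigma_rel :: "('a, 'm) monoid_scheme \<Rightarrow> 'a rel" where
  "sigma_rel S = {(a, b). a \<in> carrier S \<and> b \<in> carrier S
     \<and> (\<exists>e \<in> idempotents S. a \<otimes>\<^bsub>S\<^esub> e = b \<otimes>\<^bsub>S\<^esub> e)}"

definition semigroup_congruence :: "('a, 'm) monoid_scheme \<Rightarrow> 'a rel \<Rightarrow> bool" where
  "semigroup_congruence S R \<longleftrightarrow> equiv (carrier S) R
     \<and> (\<forall>a b c. (a, b) \<in> R \<longrightarrow> c \<in> carrier S
          \<longrightarrow> (c \<otimes>\<^bsub>S\<^esub> a, c \<otimes>\<^bsub>S\<^esub> b) \<in> R \<and> (a \<otimes>\<^bsub>S\<^esub> c, b \<otimes>\<^bsub>S\<^esub> c) \<in> R)"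

lemma PO_inf_mapsD:
  assumes "f \<in> PO_inf_maps"
  shows "f x = Some y \<Longrightarrow> x \<in> NN" and "f x = Some y \<Longrightarrow> y \<in> NN"
    and "f x = Some z \<Longrightarrow> f y = Some z \<Longrightarrow> x = y"
    and "f x = Some u \<Longrightarrow> f y = Some v \<Longrightarrow> x \<le> y \<Longrightarrow> u \<le> v"
    and "finite (NN - dom f)" and "finite (NN - ran f)"
proof -
  have f: "dom f \<subseteq> NN" "ran f \<subseteq> NN" "inj_on f (dom f)"
      "mono_on (dom f) (\<lambda>x. the (f x))" "finite (NN - dom f)" "finite (NN - ran f)"
    using assms by (auto simp: PO_inf_maps_def)
  show "f x = Some y \<Longrightarrow> x \<in> NN" using f(1) by auto
  show "f x = Some y \<Longrightarrow> y \<in> NN" using f(2) by (meson ranI subsetD)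
  show "f x = Some z \<Longrightarrow> f y = Some z \<Longrightarrow> x = y" using f(3) by (metis domI inj_onD)
  show "f x = Some u \<Longrightarrow> f y = Some v \<Longrightarrow> x \<le> y \<Longrightarrow> u \<le> v"
    using mono_onD[OF f(4), of x y] by auto
  show "finite (NN - dom f)" "finite (NN - ran f)" by fact+
qed

lemma PO_inf_maps_comp:
  assumes f: "f \<in> PO_inf_maps" and g: "g \<in> PO_inf_maps"
  shows "g \<circ>\<^sub>m f \<in> PO_inf_maps"
proof -
  note F = PO_inf_mapsD[OF f] and G = PO_inf_mapsD[OF g]
  have dr: "dom (g \<circ>\<^sub>m f) \<subseteq> NN" "ran (g \<circ>\<^sub>m f) \<subseteq> NN"
    using F(1) G(2) by (auto simp: map_comp_Some_iff ran_def)
  have inj: "inj_on (g \<circ>\<^sub>m f) (dom (g \<circ>\<^sub>m f))"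
  proof (rule inj_onI)
    fix x y assume "x \<in> dom (g \<circ>\<^sub>m f)" "y \<in> dom (g \<circ>\<^sub>m f)" "(g \<circ>\<^sub>m f) x = (g \<circ>\<^sub>m f) y"
    then obtain z where "(g \<circ>\<^sub>m f) x = Some z" "(g \<circ>\<^sub>m f) y = Some z" by auto
    then show "x = y" using F(3) G(3) unfolding map_comp_Some_iff by metis
  qed
  have mono: "mono_on (dom (g \<circ>\<^sub>m f)) (\<lambda>x. the ((g \<circ>\<^sub>m f) x))"
  proof (rule mono_onI)
    fix x y assume "x \<in> dom (g \<circ>\<^sub>m f)" "y \<in> dom (g \<circ>\<^sub>m f)" and le: "x \<le> y"
    then obtain u v where uv: "(g \<circ>\<^sub>m f) x = Some u" "(g \<circ>\<^sub>m f) y = Some v" by auto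
    then obtain p q where "f x = Some p" "g p = Some u" "f y = Some q" "g q = Some v"
      unfolding map_comp_Some_iff by blast
    then have "u \<le> v" using F(4) G(4) le by metis
    then show "the ((g \<circ>\<^sub>m f) x) \<le> the ((g \<circ>\<^sub>m f) y)" using uv by simp
  qed
  have "NN - dom (g \<circ>\<^sub>m f) \<subseteq> (NN - dom f) \<union> {x \<in> dom f. f x \<in> Some ` (NN - dom g)}"
    using F(2) by (auto simp: map_comp_def dom_def split: option.splits)
  moreover have "finite {x \<in> dom f. f x \<in> Some ` (NN - dom g)}"
  proof (rule finite_imageD)
    show "finite (f ` {x \<in> dom f. f x \<in> Some ` (NN - dom g)})"
      by (rule finite_subset[of _ "Some ` (NN - dom g)"]) (use G(5) in auto)
    show "inj_on f {x \<in> dom f. f x \<in> Some ` (NN - dom g)}"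
      using f unfolding PO_inf_maps_def by (auto intro: inj_on_subset)
  qed
  ultimately have fd: "finite (NN - dom (g \<circ>\<^sub>m f))" using F(5) by (meson finite_UnI finite_subset)
  have "NN - ran (g \<circ>\<^sub>m f) \<subseteq> (NN - ran g) \<union> (\<lambda>x. the (g x)) ` (NN - ran f)"
  proof
    fix z assume z: "z \<in> NN - ran (g \<circ>\<^sub>m f)"
    show "z \<in> (NN - ran g) \<union> (\<lambda>x. the (g x)) ` (NN - ran f)"
    proof (cases "z \<in> ran g")
      case True
      then obtain y where y: "g y = Some z" by (auto simp: ran_def)
      have "z \<in> ran (g \<circ>\<^sub>m f)" if "f x = Some y" for x
        using that y by (intro ranI[of _ x]) (simp add: map_comp_def)
      then have "y \<notin> ran f" using z by (auto simp: ran_def[of f])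
      then show ?thesis using y G(1)[OF y] by force
    qed (use z in auto)
  qed
  then have fr: "finite (NN - ran (g \<circ>\<^sub>m f))"
    using F(6) G(6) by (meson finite_UnI finite_imageI finite_subset)
  show ?thesis unfolding PO_inf_maps_def using dr inj mono fd fr by blast
qed

lemma Some_restrict_NN_in_PO_inf_maps: "Some |` NN \<in> PO_inf_maps"
proof -
  have "dom (Some |` NN) = NN" "ran (Some |` NN) = NN"
    by (auto simp: restrict_map_def ran_def dom_def split: if_splits)
  moreover have "inj_on (Some |` NN) NN" by (auto simp: inj_on_def)
  moreover have "mono_on NN (\<lambda>x. the ((Some |` NN) x))" by (auto intro: mono_onI)
  ultimately show ?thesis by (simp add: PO_inf_maps_def)
qed

lemma monoid_PO_inf: "monoid PO_inf"
proof (rule monoidI)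
  fix f assume "f \<in> carrier PO_inf"
  then have f: "f \<in> PO_inf_maps" by (simp add: PO_inf_def)
  note F = PO_inf_mapsD[OF f]
  have "f \<circ>\<^sub>m (Some |` NN) = f"
  proof
    fix x show "(f \<circ>\<^sub>m (Some |` NN)) x = f x"
      using F(1) by (cases "f x") (auto simp: map_comp_def restrict_map_def)
  qed
  then show "\<one>\<^bsub>PO_inf\<^esub> \<otimes>\<^bsub>PO_inf\<^esub> f = f" by (simp add: PO_inf_def)
  have "(Some |` NN) \<circ>\<^sub>m f = f"
  proof
    fix x show "((Some |` NN) \<circ>\<^sub>m f) x = f x"
      using F(2) by (cases "f x") (auto simp: map_comp_def restrict_map_def)
  qed
  then show "f \<otimes>\<^bsub>PO_inf\<^esub> \<one>\<^bsub>PO_inf\<^esub> = f" by (simp add: PO_inf_def)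
next
  fix f g h
  show "f \<otimes>\<^bsub>PO_inf\<^esub> g \<otimes>\<^bsub>PO_inf\<^esub> h = f \<otimes>\<^bsub>PO_inf\<^esub> (g \<otimes>\<^bsub>PO_inf\<^esub> h)"
    by (auto simp: PO_inf_def map_comp_def split: option.splits)
qed (auto simp: PO_inf_def PO_inf_maps_comp Some_restrict_NN_in_PO_inf_maps)

end

theory Submission
  imports Defs
begin

text \<open>
  All five conditions say the same thing: \<open>\<alpha>\<close> and \<open>\<beta>\<close> differ at only finitely many points, where
  being undefined counts as a value.

  The reason is that an idempotent injective partial map is the identity on its domain
  (\<open>idempotents_PO_inf\<close>), so multiplying by an idempotent on either side only restricts a map. As
  the domain of the idempotent is cofinite and the maps are injective, only finitely many points are
  lost (\<open>almost_equal_mult_idempotent\<close>, \<open>almost_equal_idempotent_mult\<close>). Since almost equality is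
  an equivalence relation, every one of the five conditions forces \<open>\<alpha>\<close> and \<open>\<beta>\<close> to be almost equal.

  Conversely, if \<open>\<alpha>\<close> and \<open>\<beta>\<close> are almost equal, the idempotent deleting the finitely many points of
  disagreement equalizes them from the left, and the idempotent deleting the finitely many values
  taken at those points equalizes them from the right. The mixed condition \<open>\<alpha>\<zeta> = \<upsilon>\<beta>\<close> then follows,
  because restricting the range of a map amounts to restricting its domain (\<open>mult_idempotent_commute\<close>).

  The congruence property can be read off from almost equality: multiplying by \<open>\<gamma>\<close> on the right
  adds no points of disagreement, and multiplying by \<open>\<gamma>\<close> on the left replaces the set of these
  points by its preimage under the injective map \<open>\<gamma>\<close>.
\<close>

definition almost_equal :: "('a \<Rightarrow> 'b) \<Rightarrow> ('a \<Rightarrow> 'b) \<Rightarrow> bool" where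
  "almost_equal f g \<longleftrightarrow> finite {x. f x \<noteq> g x}"

lemma almost_equal_refl: "almost_equal f f"
  by (simp add: almost_equal_def)

lemma almost_equal_sym: "almost_equal f g \<Longrightarrow> almost_equal g f"
  by (simp add: almost_equal_def eq_commute)

lemma almost_equal_trans:
  assumes "almost_equal f g" "almost_equal g h"
  shows "almost_equal f h"
proof -
  have "{x. f x \<noteq> h x} \<subseteq> {x. f x \<noteq> g x} \<union> {x. g x \<noteq> h x}" by auto
  then show ?thesis using assms unfolding almost_equal_def by (meson finite_UnI finite_subset)
qed

lemma mult_PO_inf: "f \<otimes>\<^bsub>PO_inf\<^esub> g = g \<circ>\<^sub>m f"
  by (simp add: PO_inf_def)

lemma carrier_PO_inf: "carrier PO_inf = PO_inf_maps"
  by (simp add: PO_inf_def)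

lemma finite_preimage_PO_inf_maps:
  assumes f: "f \<in> PO_inf_maps" and B: "finite B"
  shows "finite {x. \<exists>y\<in>B. f x = Some y}"
proof (rule finite_imageD)
  show "finite (f ` {x. \<exists>y\<in>B. f x = Some y})"
    by (rule finite_subset[of _ "Some ` B"]) (use B in auto)
  show "inj_on f {x. \<exists>y\<in>B. f x = Some y}"
    using PO_inf_mapsD(3)[OF f] by (auto intro!: inj_onI)
qed

lemma restrict_Some_idempotent:
  assumes "A \<subseteq> NN" "finite (NN - A)"
  shows "Some |` A \<in> idempotents PO_inf"
proof -
  have "dom (Some |` A) = A" "ran (Some |` A) = A"
    by (auto simp: restrict_map_def ran_def dom_def split: if_splits)
  moreover have "inj_on (Some |` A) A" "mono_on A (\<lambda>x. the ((Some |` A) x))"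
    by (auto simp: inj_on_def intro: mono_onI)
  ultimately have "Some |` A \<in> PO_inf_maps" using assms by (simp add: PO_inf_maps_def)
  moreover have "(Some |` A) \<circ>\<^sub>m (Some |` A) = Some |` A"
    by (auto simp: map_comp_def restrict_map_def split: option.splits)
  ultimately show ?thesis by (simp add: idempotents_def carrier_PO_inf mult_PO_inf)
qed

text \<open>If \<open>e\<close> sends \<open>x\<close> to \<open>y\<close> and is idempotent, it also sends \<open>y\<close> to \<open>y\<close>, so \<open>x = y\<close> by
  injectivity.\<close>

lemma idempotents_PO_inf:
  "idempotents PO_inf = {Some |` A | A. A \<subseteq> NN \<and> finite (NN - A)}"
proof (intro equalityI subsetI)
  fix e assume "e \<in> idempotents PO_inf"
  then have e: "e \<in> PO_inf_maps" and ee: "e \<circ>\<^sub>m e = e"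
    by (simp_all add: idempotents_def carrier_PO_inf mult_PO_inf)
  note E = PO_inf_mapsD[OF e]
  have "y = x" if "e x = Some y" for x y
  proof -
    have "e y = Some y" using that ee by (metis map_comp_simps(2))
    then show ?thesis using that E(3) by blast
  qed
  then have "e x = (Some |` dom e) x" for x
    by (cases "e x") (auto simp: restrict_map_def dom_def)
  then have "e = Some |` dom e" by (rule ext)
  moreover have "dom e \<subseteq> NN" using E(1) by auto
  ultimately show "e \<in> {Some |` A | A. A \<subseteq> NN \<and> finite (NN - A)}" using E(5) by blast
qed (auto intro: restrict_Some_idempotent)

lemma mult_restrict_Some_left: "(Some |` A) \<otimes>\<^bsub>PO_inf\<^esub> f = f |` A"
  by (auto simp: mult_PO_inf map_comp_def restrict_map_def)

lemma almost_equal_idempotent_mult: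
  assumes f: "f \<in> carrier PO_inf" and e: "e \<in> idempotents PO_inf"
  shows "almost_equal f (e \<otimes>\<^bsub>PO_inf\<^esub> f)"
proof -
  obtain A where A: "finite (NN - A)" "e = Some |` A" using e by (auto simp: idempotents_PO_inf)
  have "x \<in> NN" if "f x \<noteq> None" for x
    using that PO_inf_mapsD(1)[of f x] f by (auto simp: carrier_PO_inf)
  then have "{x. f x \<noteq> (f |` A) x} \<subseteq> NN - A" by (auto simp: restrict_map_def)
  then show ?thesis
    using A by (auto simp: almost_equal_def mult_restrict_Some_left intro: finite_subset)
qed

text \<open>Cutting the range of \<open>f\<close> down to \<open>A\<close> is cutting its domain down to the preimage of \<open>A\<close>. Points
  outside the domain of \<open>f\<close> may be kept in the domain of \<open>e'\<close>, so that the latter misses only the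
  preimage of a finite set.\<close>

lemma mult_idempotent_commute:
  assumes f: "f \<in> carrier PO_inf" and e: "e \<in> idempotents PO_inf"
  obtains e' where "e' \<in> idempotents PO_inf" "f \<otimes>\<^bsub>PO_inf\<^esub> e = e' \<otimes>\<^bsub>PO_inf\<^esub> f"
proof -
  have f: "f \<in> PO_inf_maps" using f by (simp add: carrier_PO_inf)
  obtain A where A: "A \<subseteq> NN" "finite (NN - A)" "e = Some |` A"
    using e by (auto simp: idempotents_PO_inf)
  define D where "D = {x. \<exists>y\<in>NN - A. f x = Some y}"
  have "NN - (NN - D) \<subseteq> D" by auto
  then have "finite (NN - (NN - D))"
    using finite_preimage_PO_inf_maps[OF f A(2)] unfolding D_def by (rule finite_subset)
  then have "Some |` (NN - D) \<in> idempotents PO_inf"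
    by (intro restrict_Some_idempotent) auto
  moreover have "(f \<otimes>\<^bsub>PO_inf\<^esub> e) x = (f |` (NN - D)) x" for x
    using PO_inf_mapsD(1,2)[OF f, of x] A(1)
    by (cases "f x") (auto simp: mult_PO_inf map_comp_def restrict_map_def A(3) D_def)
  ultimately show ?thesis using that by (metis ext mult_restrict_Some_left)
qed

lemma almost_equal_mult_idempotent:
  assumes "f \<in> carrier PO_inf" "e \<in> idempotents PO_inf"
  shows "almost_equal f (f \<otimes>\<^bsub>PO_inf\<^esub> e)"
  using mult_idempotent_commute[OF assms] almost_equal_idempotent_mult[OF assms(1)] by metis

lemma almost_equal_imp_left_equalizer:
  assumes "almost_equal f g"
  obtains e where "e \<in> idempotents PO_inf" "e \<otimes>\<^bsub>PO_inf\<^esub> f = e \<otimes>\<^bsub>PO_inf\<^esub> g"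
proof
  let ?A = "{x \<in> NN. f x = g x}"
  show "Some |` ?A \<in> idempotents PO_inf"
    using assms unfolding almost_equal_def
    by (intro restrict_Some_idempotent) (auto intro: finite_subset[rotated])
  show "(Some |` ?A) \<otimes>\<^bsub>PO_inf\<^esub> f = (Some |` ?A) \<otimes>\<^bsub>PO_inf\<^esub> g"
    unfolding mult_restrict_Some_left by (auto simp: restrict_map_def)
qed

lemma almost_equal_imp_right_equalizer:
  assumes "almost_equal f g"
  obtains e where "e \<in> idempotents PO_inf" "f \<otimes>\<^bsub>PO_inf\<^esub> e = g \<otimes>\<^bsub>PO_inf\<^esub> e"
proof
  define D where "D = {x. f x \<noteq> g x}"
  \<comment> \<open>At a point where one map is undefined, \<open>the\<close> yields some arbitrary value; deleting it as
    well does no harm.\<close>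
  define V where "V = (\<lambda>x. the (f x)) ` D \<union> (\<lambda>x. the (g x)) ` D"
  have "finite V" using assms by (simp add: V_def D_def almost_equal_def)
  then show "Some |` (NN - V) \<in> idempotents PO_inf"
    by (intro restrict_Some_idempotent) (auto intro: finite_subset[rotated])
  have undefined_outside: "(h \<otimes>\<^bsub>PO_inf\<^esub> (Some |` (NN - V))) x = None"
    if "x \<in> D" "the (h x) \<in> V" for h x
    using that by (cases "h x") (auto simp: mult_PO_inf map_comp_def restrict_map_def)
  show "f \<otimes>\<^bsub>PO_inf\<^esub> (Some |` (NN - V)) = g \<otimes>\<^bsub>PO_inf\<^esub> (Some |` (NN - V))"
  proof
    fix x
    show "(f \<otimes>\<^bsub>PO_inf\<^esub> (Some |` (NN - V))) x = (g \<otimes>\<^bsub>PO_inf\<^esub> (Some |` (NN - V))) x"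
    proof (cases "x \<in> D")
      case True
      then show ?thesis using undefined_outside by (simp add: V_def)
    next
      case False
      then show ?thesis by (simp add: D_def mult_PO_inf map_comp_def)
    qed
  qed
qed

lemma sigma_rel_PO_inf_iff:
  "(f, g) \<in> sigma_rel PO_inf \<longleftrightarrow> f \<in> carrier PO_inf \<and> g \<in> carrier PO_inf \<and> almost_equal f g"
proof
  assume "(f, g) \<in> sigma_rel PO_inf"
  then obtain e where "f \<in> carrier PO_inf" "g \<in> carrier PO_inf" "e \<in> idempotents PO_inf"
      "f \<otimes>\<^bsub>PO_inf\<^esub> e = g \<otimes>\<^bsub>PO_inf\<^esub> e"
    by (auto simp: sigma_rel_def)
  then show "f \<in> carrier PO_inf \<and> g \<in> carrier PO_inf \<and> almost_equal f g"
    by (metis almost_equal_mult_idempotent almost_equal_sym almost_equal_trans)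
next
  assume "f \<in> carrier PO_inf \<and> g \<in> carrier PO_inf \<and> almost_equal f g"
  then show "(f, g) \<in> sigma_rel PO_inf"
    by (auto simp: sigma_rel_def elim: almost_equal_imp_right_equalizer)
qed

lemma almost_equal_mult_left:
  assumes h: "h \<in> carrier PO_inf" and fg: "almost_equal f g"
  shows "almost_equal (h \<otimes>\<^bsub>PO_inf\<^esub> f) (h \<otimes>\<^bsub>PO_inf\<^esub> g)"
proof -
  have "{x. (h \<otimes>\<^bsub>PO_inf\<^esub> f) x \<noteq> (h \<otimes>\<^bsub>PO_inf\<^esub> g) x} \<subseteq> {x. \<exists>y\<in>{y. f y \<noteq> g y}. h x = Some y}"
    by (auto simp: mult_PO_inf map_comp_def split: option.splits)
  then show ?thesis
    using finite_preimage_PO_inf_maps[of h "{y. f y \<noteq> g y}"] h fg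
    unfolding almost_equal_def carrier_PO_inf by (meson finite_subset)
qed

lemma almost_equal_mult_right:
  assumes "almost_equal f g"
  shows "almost_equal (f \<otimes>\<^bsub>PO_inf\<^esub> h) (g \<otimes>\<^bsub>PO_inf\<^esub> h)"
proof -
  have "{x. (f \<otimes>\<^bsub>PO_inf\<^esub> h) x \<noteq> (g \<otimes>\<^bsub>PO_inf\<^esub> h) x} \<subseteq> {x. f x \<noteq> g x}"
    by (auto simp: mult_PO_inf map_comp_def)
  then show ?thesis using assms unfolding almost_equal_def by (rule finite_subset)
qed

lemma semigroup_congruence_sigma_rel: "semigroup_congruence PO_inf (sigma_rel PO_inf)"
proof -
  interpret monoid PO_inf by (rule monoid_PO_inf)
  have "equiv (carrier PO_inf) (sigma_rel PO_inf)"
    by (rule equivI)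
      (auto simp: refl_on_def sym_def trans_def sigma_rel_PO_inf_iff
        intro: almost_equal_refl almost_equal_sym almost_equal_trans)
  then show ?thesis
    unfolding semigroup_congruence_def sigma_rel_PO_inf_iff
    by (auto intro: almost_equal_mult_left almost_equal_mult_right)
qed

theorem proposition5:
  shows "(\<forall>\<alpha> \<in> carrier PO_inf. \<forall>\<beta> \<in> carrier PO_inf.
      ((\<alpha>, \<beta>) \<in> sigma_rel PO_inf \<longleftrightarrow>
         (\<exists>\<zeta> \<in> idempotents PO_inf. \<exists>\<upsilon> \<in> idempotents PO_inf.
            \<alpha> \<otimes>\<^bsub>PO_inf\<^esub> \<zeta> = \<beta> \<otimes>\<^bsub>PO_inf\<^esub> \<upsilon>)) \<and>
      ((\<alpha>, \<beta>) \<in> sigma_rel PO_inf \<longleftrightarrow>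
         (\<exists>\<zeta> \<in> idempotents PO_inf. \<exists>\<upsilon> \<in> idempotents PO_inf.
            \<alpha> \<otimes>\<^bsub>PO_inf\<^esub> \<zeta> = \<upsilon> \<otimes>\<^bsub>PO_inf\<^esub> \<beta>)) \<and>
      ((\<alpha>, \<beta>) \<in> sigma_rel PO_inf \<longleftrightarrow>
         (\<exists>\<iota> \<in> idempotents PO_inf.
            \<iota> \<otimes>\<^bsub>PO_inf\<^esub> \<alpha> = \<iota> \<otimes>\<^bsub>PO_inf\<^esub> \<beta>)) \<and>
      ((\<alpha>, \<beta>) \<in> sigma_rel PO_inf \<longleftrightarrow>
         (\<exists>\<zeta> \<in> idempotents PO_inf. \<exists>\<upsilon> \<in> idempotents PO_inf.
            \<zeta> \<otimes>\<^bsub>PO_inf\<^esub> \<alpha> = \<upsilon> \<otimes>\<^bsub>PO_inf\<^esub> \<beta>)))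
    \<and> semigroup_congruence PO_inf (sigma_rel PO_inf)"
proof (intro conjI ballI semigroup_congruence_sigma_rel)
  fix \<alpha> \<beta> assume \<alpha>: "\<alpha> \<in> carrier PO_inf" and \<beta>: "\<beta> \<in> carrier PO_inf"
  let ?I = "idempotents PO_inf"
  have sigma: "(\<alpha>, \<beta>) \<in> sigma_rel PO_inf \<longleftrightarrow> almost_equal \<alpha> \<beta>"
    using \<alpha> \<beta> by (simp add: sigma_rel_PO_inf_iff)
  note restrict_\<alpha> = almost_equal_mult_idempotent[OF \<alpha>] almost_equal_idempotent_mult[OF \<alpha>]
  note restrict_\<beta> = almost_equal_mult_idempotent[OF \<beta>] almost_equal_idempotent_mult[OF \<beta>]
  have common: "almost_equal \<alpha> \<beta>" if "almost_equal \<alpha> f" "almost_equal \<beta> g" "f = g" for f g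
    using that almost_equal_sym almost_equal_trans by blast
  show "(\<alpha>, \<beta>) \<in> sigma_rel PO_inf \<longleftrightarrow>
      (\<exists>\<zeta>\<in>?I. \<exists>\<upsilon>\<in>?I. \<alpha> \<otimes>\<^bsub>PO_inf\<^esub> \<zeta> = \<beta> \<otimes>\<^bsub>PO_inf\<^esub> \<upsilon>)" (is "_ \<longleftrightarrow> ?ii")
  proof
    show "?ii" if "(\<alpha>, \<beta>) \<in> sigma_rel PO_inf"
      using that unfolding sigma_rel_def by blast
    show "(\<alpha>, \<beta>) \<in> sigma_rel PO_inf" if "?ii"
      using that restrict_\<alpha>(1) restrict_\<beta>(1) common unfolding sigma by blast
  qed
  show "(\<alpha>, \<beta>) \<in> sigma_rel PO_inf \<longleftrightarrow>
      (\<exists>\<zeta>\<in>?I. \<exists>\<upsilon>\<in>?I. \<alpha> \<otimes>\<^bsub>PO_inf\<^esub> \<zeta> = \<upsilon> \<otimes>\<^bsub>PO_inf\<^esub> \<beta>)" (is "_ \<longleftrightarrow> ?iii")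
  proof
    assume "(\<alpha>, \<beta>) \<in> sigma_rel PO_inf"
    then obtain \<epsilon> where \<epsilon>: "\<epsilon> \<in> ?I" "\<alpha> \<otimes>\<^bsub>PO_inf\<^esub> \<epsilon> = \<beta> \<otimes>\<^bsub>PO_inf\<^esub> \<epsilon>"
      unfolding sigma_rel_def by blast
    obtain \<upsilon> where "\<upsilon> \<in> ?I" "\<beta> \<otimes>\<^bsub>PO_inf\<^esub> \<epsilon> = \<upsilon> \<otimes>\<^bsub>PO_inf\<^esub> \<beta>"
      by (rule mult_idempotent_commute[OF \<beta> \<epsilon>(1)])
    then show "?iii" using \<epsilon> by auto
  next
    show "(\<alpha>, \<beta>) \<in> sigma_rel PO_inf" if "?iii"
      using that restrict_\<alpha>(1) restrict_\<beta>(2) common unfolding sigma by blast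
  qed
  have left_equalizer: "\<exists>\<iota>\<in>?I. \<iota> \<otimes>\<^bsub>PO_inf\<^esub> \<alpha> = \<iota> \<otimes>\<^bsub>PO_inf\<^esub> \<beta>" if "(\<alpha>, \<beta>) \<in> sigma_rel PO_inf"
    using that almost_equal_imp_left_equalizer unfolding sigma by blast
  have left_common: "(\<alpha>, \<beta>) \<in> sigma_rel PO_inf"
    if "\<zeta> \<in> ?I" "\<upsilon> \<in> ?I" "\<zeta> \<otimes>\<^bsub>PO_inf\<^esub> \<alpha> = \<upsilon> \<otimes>\<^bsub>PO_inf\<^esub> \<beta>" for \<zeta> \<upsilon>
    using that restrict_\<alpha>(2) restrict_\<beta>(2) common unfolding sigma by blast
  show "(\<alpha>, \<beta>) \<in> sigma_rel PO_inf \<longleftrightarrow>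
      (\<exists>\<iota>\<in>?I. \<iota> \<otimes>\<^bsub>PO_inf\<^esub> \<alpha> = \<iota> \<otimes>\<^bsub>PO_inf\<^esub> \<beta>)"
    using left_equalizer left_common by blast
  show "(\<alpha>, \<beta>) \<in> sigma_rel PO_inf \<longleftrightarrow>
      (\<exists>\<zeta>\<in>?I. \<exists>\<upsilon>\<in>?I. \<zeta> \<otimes>\<^bsub>PO_inf\<^esub> \<alpha> = \<upsilon> \<otimes>\<^bsub>PO_inf\<^esub> \<beta>)"
    using left_equalizer left_common by blast
qed

end
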